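(* Let $r\ge1$ and $\lambda>0$. Given two finite scenario trees of height $T$, let $\boldsymbol d_W^r$ be the optimal value and $\pi^W$ an optimal solution of the nested distance problem, let $\pi^S$ be the optimal solution of the entropy-regularized nested problem with parameter $\lambda$, and put $\boldsymbol d_S^r:=\sum_{i,j}\pi^S_{ij}d_{ij}^r$ and $\boldsymbol{de}_S^r:=\sum_{i,j}\pi^S_{ij}d_{ij}^r-\frac1\lambda H(\pi^S)$. Then $$0\le\boldsymbol d_S^r-\boldsymbol d_W^r\le\frac1\lambda\bigl(H(\pi^S)-H(\pi^W)\bigr) \quad\text{and}\quad 0\le\boldsymbol d_W^r-\boldsymbol{de}_S^r\le\frac1\lambda H(\pi^S)\le\frac1\lambda H(p\cdot\tilde p^\top),$$ where $p$ and $\tilde p$ are the vectors of unconditional probabilities of the leaves (final stage $T$) of the first and the second tree, and $p\cdot\tilde p^\top$ is the matrix with entries $p_i\tilde p_j$.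
   Context: Trees: A finite-valued process with its filtration is modelled by a finite rooted tree of height $T$. $\mathcal N_t$ (resp. $\tilde{\mathcal N}_t$) denotes the set of nodes at stage $t=0,\dots,T$ of the first (resp. second) tree; stage $0$ consists of the root only, and all leaves are at stage $T$. We write $m\prec i$ (equivalently $i\succ m$) if $m$ is a (not necessarily immediate) predecessor of $i$. The first tree carries a probability measure $P$ on its leaves with weights $p_i$ and the second a probability measure $\tilde P$ with weights $\tilde p_j$, all weights positive; $P(i\mid i_t)=p_i/\sum_{i'\in\mathcal N_T,\,i'\succ i_t}p_{i'}$ for a leaf $i\succ i_t$, and similarly $\tilde P(j\mid j_t)$. For leaves $i\in\mathcal N_T$, $j\in\tilde{\mathcal N}_T$, $d_{ij}\ge 0$ is the distance between the trajectories ending in $i$ and $j$. Nested distance problem: minimize $\sum_{i,j}\pi_{ij}d_{ij}^r$ over $\pi$ on $\mathcal N_T\times\tilde{\mathcal N}_T$ subject to, for all $t\in\{0,\dots,T-1\}$, $i_t\in\mathcal N_t$, $j_t\in\tilde{\mathcal N}_t$, $$\sum_{j\succ j_t}\pi(i,j\mid i_t,j_t)=P(i\mid i_t)\ \ (i\in\mathcal N_T,\ i\succ i_t),\qquad \sum_{i\succ i_t}\pi(i,j\mid i_t,j_t)=\tilde P(j\mid j_t)\ \ (j\in\tilde{\mathcal N}_T,\ j\succ j_t),$$ and $\pi_{ij}\ge 0$, $\sum_{i,j}\pi_{ij}=1$, where $\pi(i,j\mid i_t,j_t):=\pi_{ij}\big/\sum_{i'\succ i_t,\,j'\succ j_t}\pi_{i'j'}$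 (sums over leaves). The constraints are understood as linear constraints in $\pi$, i.e. after multiplying by the denominator. Its optimal value is denoted $\boldsymbol d_W^r$ and an optimal solution $\pi^W$. Entropy: $H(\pi):=-\sum_{i,j}\pi_{ij}\log\pi_{ij}$, with $0\log0:=0$. Entropy-regularized nested problem: minimize $\sum_{i,j}\pi_{ij}d_{ij}^r-\frac1\lambda H(\pi)$ subject to the same conditional constraints together with $\pi_{ij}>0$ and $\sum_{i,j}\pi_{ij}=1$. Its optimal solution is denoted $\pi^S$. The symbols $\boldsymbol d_W^r$, $\boldsymbol d_S^r$, $\boldsymbol{de}_S^r$ denote the numbers just defined; no $r$-th root is taken. *)

theory Defs
  imports Complex_Main
begin

text \<open>
  A finite rooted tree with edges directed from parent to child, together with weights
  on its nodes, of which only those of the leaves matter.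
\<close>

record 'a scenario_tree =
  nodes :: "'a set"
  edges :: "('a \<times> 'a) set"
  root :: 'a
  leaf_prob :: "'a \<Rightarrow> real"

definition rooted_tree :: "('a, 'z) scenario_tree_scheme \<Rightarrow> bool" where
  "rooted_tree A \<longleftrightarrow>
     finite (nodes A) \<and> edges A \<subseteq> nodes A \<times> nodes A \<and> root A \<in> nodes A \<and>
     (\<forall>m. (m, root A) \<notin> edges A) \<and>
     (\<forall>n \<in> nodes A - {root A}. \<exists>!m. (m, n) \<in> edges A) \<and>
     (\<forall>n \<in> nodes A. (root A, n) \<in> (edges A)\<^sup>*)"

definition leaves :: "('a, 'z) scenario_tree_scheme \<Rightarrow> 'a set" where
  "leaves A = {n \<in> nodes A. \<forall>n'. (n, n') \<notin> edges A}"

definition stage :: "('a, 'z) scenario_tree_scheme \<Rightarrow> nat \<Rightarrow> 'a set" where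
  "stage A t = {n \<in> nodes A. (root A, n) \<in> edges A ^^ t}"

definition predecessor :: "('a, 'z) scenario_tree_scheme \<Rightarrow> 'a \<Rightarrow> 'a \<Rightarrow> bool" where
  "predecessor A m n \<longleftrightarrow> (m, n) \<in> (edges A)\<^sup>+"

definition leaves_below :: "('a, 'z) scenario_tree_scheme \<Rightarrow> 'a \<Rightarrow> 'a set" where
  "leaves_below A m = {i \<in> leaves A. predecessor A m i}"

definition is_scenario_tree :: "('a, 'z) scenario_tree_scheme \<Rightarrow> nat \<Rightarrow> bool" where
  "is_scenario_tree A T \<longleftrightarrow>
     rooted_tree A \<and> leaves A = stage A T \<and>
     (\<forall>i \<in> leaves A. leaf_prob A i > 0) \<and> (\<Sum>i \<in> leaves A. leaf_prob A i) = 1"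

definition cond_prob :: "('a, 'z) scenario_tree_scheme \<Rightarrow> 'a \<Rightarrow> 'a \<Rightarrow> real" where
  "cond_prob A i m = leaf_prob A i / (\<Sum>i' \<in> leaves_below A m. leaf_prob A i')"

text \<open>
  The constraints prescribing the conditional probabilities of \<open>\<pi>\<close> given a pair of nodes of
  the same stage \<open>t < T\<close>, multiplied by the mass \<open>M\<close> that \<open>\<pi>\<close> gives to the pairs of leaves below
  that pair of nodes. Hence they are linear in \<open>\<pi>\<close>, and they hold whenever \<open>M = 0\<close> and \<open>\<pi> \<ge> 0\<close>.
  The values of \<open>\<pi>\<close> outside of pairs of leaves are irrelevant throughout.
\<close>

definition conditional_constraints ::
    "('a, 'y) scenario_tree_scheme \<Rightarrow> ('b, 'z) scenario_tree_scheme \<Rightarrow> nat \<Rightarrow>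
     ('a \<Rightarrow> 'b \<Rightarrow> real) \<Rightarrow> bool" where
  "conditional_constraints A B T \<pi> \<longleftrightarrow>
     (\<forall>t < T. \<forall>m \<in> stage A t. \<forall>n \<in> stage B t.
        let M = (\<Sum>i' \<in> leaves_below A m. \<Sum>j' \<in> leaves_below B n. \<pi> i' j') in
          (\<forall>i \<in> leaves_below A m. (\<Sum>j \<in> leaves_below B n. \<pi> i j) = cond_prob A i m * M) \<and>
          (\<forall>j \<in> leaves_below B n. (\<Sum>i \<in> leaves_below A m. \<pi> i j) = cond_prob B j n * M))"

definition nested_feasible ::
    "('a, 'y) scenario_tree_scheme \<Rightarrow> ('b, 'z) scenario_tree_scheme \<Rightarrow> nat \<Rightarrow>
     ('a \<Rightarrow> 'b \<Rightarrow> real) \<Rightarrow> bool" where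
  "nested_feasible A B T \<pi> \<longleftrightarrow>
     conditional_constraints A B T \<pi> \<and>
     (\<forall>i \<in> leaves A. \<forall>j \<in> leaves B. \<pi> i j \<ge> 0) \<and>
     (\<Sum>i \<in> leaves A. \<Sum>j \<in> leaves B. \<pi> i j) = 1"

definition regularized_feasible ::
    "('a, 'y) scenario_tree_scheme \<Rightarrow> ('b, 'z) scenario_tree_scheme \<Rightarrow> nat \<Rightarrow>
     ('a \<Rightarrow> 'b \<Rightarrow> real) \<Rightarrow> bool" where
  "regularized_feasible A B T \<pi> \<longleftrightarrow>
     conditional_constraints A B T \<pi> \<and>
     (\<forall>i \<in> leaves A. \<forall>j \<in> leaves B. \<pi> i j > 0) \<and>
     (\<Sum>i \<in> leaves A. \<Sum>j \<in> leaves B. \<pi> i j) = 1"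

definition transport_cost ::
    "('a, 'y) scenario_tree_scheme \<Rightarrow> ('b, 'z) scenario_tree_scheme \<Rightarrow>
     ('a \<Rightarrow> 'b \<Rightarrow> real) \<Rightarrow> real \<Rightarrow> ('a \<Rightarrow> 'b \<Rightarrow> real) \<Rightarrow> real" where
  "transport_cost A B d r \<pi> = (\<Sum>i \<in> leaves A. \<Sum>j \<in> leaves B. \<pi> i j * d i j powr r)"

text \<open>The convention \<open>0 log 0 = 0\<close> holds since the product is \<open>0\<close> for any value of \<open>ln 0\<close>.\<close>

definition entropy ::
    "('a, 'y) scenario_tree_scheme \<Rightarrow> ('b, 'z) scenario_tree_scheme \<Rightarrow>
     ('a \<Rightarrow> 'b \<Rightarrow> real) \<Rightarrow> real" where
  "entropy A B \<pi> = - (\<Sum>i \<in> leaves A. \<Sum>j \<in> leaves B. \<pi> i j * ln (\<pi> i j))"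

definition regularized_cost ::
    "('a, 'y) scenario_tree_scheme \<Rightarrow> ('b, 'z) scenario_tree_scheme \<Rightarrow>
     ('a \<Rightarrow> 'b \<Rightarrow> real) \<Rightarrow> real \<Rightarrow> real \<Rightarrow> ('a \<Rightarrow> 'b \<Rightarrow> real) \<Rightarrow> real" where
  "regularized_cost A B d r lam \<pi> = transport_cost A B d r \<pi> - 1 / lam * entropy A B \<pi>"

text \<open>The optimal value of the nested distance problem; no \<open>r\<close>-th root is taken.\<close>

definition nested_value ::
    "('a, 'y) scenario_tree_scheme \<Rightarrow> ('b, 'z) scenario_tree_scheme \<Rightarrow> nat \<Rightarrow>
     ('a \<Rightarrow> 'b \<Rightarrow> real) \<Rightarrow> real \<Rightarrow> real" where
  "nested_value A B T d r =
     (INF \<pi> \<in> {\<pi>. nested_feasible A B T \<pi>}. transport_cost A B d r \<pi>)"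

end

theory Submission
  imports Defs
begin

text \<open>
  The feasible sets are convex, and the midpoint of \<open>\<pi>W\<close> and \<open>\<pi>S\<close> is strictly positive, so it
  competes with \<open>\<pi>S\<close> in the regularized problem. Strict positivity of the competitors of \<open>\<pi>S\<close>
  is thereby harmless: convexity of the regularized cost along this segment gives
  \<open>regularized_cost \<pi>S \<le> regularized_cost \<pi>W\<close> without a limiting argument. All bounds follow
  from this, from the optimality of \<open>\<pi>W\<close> and from \<open>entropy \<pi>W \<ge> 0\<close>, except for the last one,
  which is the subadditivity of entropy, as the constraints at the root fix the marginals of \<open>\<pi>S\<close>.
\<close>

text \<open>The convex function \<open>x * ln x\<close> lies above its tangent at \<open>y\<close>;
  this is \<open>ln u \<le> u - 1\<close> at \<open>u = y / x\<close>, scaled by \<open>x\<close>.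
  It yields both the concavity of entropy and Gibbs' inequality.\<close>

lemma mult_ln_diff_ge:
  fixes x y :: real
  assumes "x \<ge> 0" and "y > 0"
  shows "x - y \<le> x * ln x - x * ln y"
proof (cases "x = 0")
  case False
  with assms have "x > 0" by simp
  have "ln (y / x) \<le> y / x - 1"
    using \<open>x > 0\<close> \<open>y > 0\<close> by (intro ln_le_minus_one) simp
  then have "x * (ln y - ln x) \<le> x * (y / x - 1)"
    using \<open>x > 0\<close> \<open>y > 0\<close> by (intro mult_left_mono) (simp_all add: ln_div)
  then show ?thesis
    using \<open>x > 0\<close> by (simp add: algebra_simps)
qed (use assms in simp)

lemma mult_ln_midpoint_le:
  fixes x y :: real
  assumes "x \<ge> 0" and "y > 0"
  shows "(x + y) / 2 * ln ((x + y) / 2) \<le> (x * ln x + y * ln y) / 2"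
proof -
  define z where "z = (x + y) / 2"
  \<comment> \<open>Both tangent inequalities are taken at the midpoint \<open>z\<close>, positive
    because \<open>y\<close> is; their left-hand sides add up to zero.\<close>
  have "x - z \<le> x * ln x - x * ln z" and "y - z \<le> y * ln y - y * ln z"
    using assms by (intro mult_ln_diff_ge; simp add: z_def)+
  moreover have "x + y = 2 * z"
    by (simp add: z_def)
  moreover from this have "x * ln z + y * ln z = 2 * (z * ln z)"
    by (simp flip: distrib_right)
  ultimately have "2 * (z * ln z) \<le> x * ln x + y * ln y"
    by linarith
  then show ?thesis
    unfolding z_def[symmetric] by simp
qed

lemma sum_midpoint:
  fixes f g :: "'i \<Rightarrow> real"
  shows "(\<Sum>i\<in>I. (f i + g i) / 2) = (sum f I + sum g I) / 2"
  by (simp add: sum.distrib flip: sum_divide_distrib)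

lemma is_scenario_treeD:
  assumes "is_scenario_tree A T"
  shows "finite (leaves A)" and "root A \<in> stage A 0" and "leaves A = stage A T"
    and "\<And>i. i \<in> leaves A \<Longrightarrow> leaf_prob A i > 0" and "(\<Sum>i\<in>leaves A. leaf_prob A i) = 1"
  using assms by (auto simp: is_scenario_tree_def rooted_tree_def leaves_def stage_def)

text \<open>Predecessors are strict, so \<open>T > 0\<close> matters: in a tree of height 0 the root
  is itself a leaf and has no leaf below it.\<close>

lemma leaves_below_root:
  assumes "is_scenario_tree A T" and "T > 0"
  shows "leaves_below A (root A) = leaves A"
proof -
  have "(root A, i) \<in> (edges A)\<^sup>+" if "i \<in> leaves A" for i
    using that is_scenario_treeD(3)[OF assms(1)] \<open>T > 0\<close> by (auto simp: stage_def trancl_power)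
  then show ?thesis
    by (auto simp: leaves_below_def predecessor_def)
qed

text \<open>At the pair of roots, the mass of \<open>\<pi>\<close> and the denominators of both
  conditional probabilities are 1, so the constraints for \<open>t = 0\<close> are the marginal
  conditions.\<close>

lemma nested_feasible_marginals:
  assumes A: "is_scenario_tree A T" and B: "is_scenario_tree B T"
    and \<pi>: "nested_feasible A B T \<pi>"
  shows "i \<in> leaves A \<Longrightarrow> (\<Sum>j\<in>leaves B. \<pi> i j) = leaf_prob A i"
    and "j \<in> leaves B \<Longrightarrow> (\<Sum>i\<in>leaves A. \<pi> i j) = leaf_prob B j"
proof -
  note DA = is_scenario_treeD[OF A] and DB = is_scenario_treeD[OF B]
  have total: "(\<Sum>i\<in>leaves A. \<Sum>j\<in>leaves B. \<pi> i j) = 1"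
    using \<pi> by (simp add: nested_feasible_def)
  have "(\<forall>i\<in>leaves A. (\<Sum>j\<in>leaves B. \<pi> i j) = leaf_prob A i) \<and>
        (\<forall>j\<in>leaves B. (\<Sum>i\<in>leaves A. \<pi> i j) = leaf_prob B j)"
  \<comment> \<open>For \<open>T = 0\<close> there are no constraints, but each tree has a single
    leaf and the normalizations suffice.\<close>
  proof (cases "T = 0")
    case True
    then have "leaves A = {root A}" and "leaves B = {root B}"
      using DA(2,3) DB(2,3) by (auto simp: stage_def)
    then show ?thesis
      using total DA(5) DB(5) by simp
  next
    case False
    then show ?thesis
      using \<pi> DA(2) DB(2) total leaves_below_root[OF A] leaves_below_root[OF B] DA(5) DB(5)
      by (force simp: nested_feasible_def conditional_constraints_def cond_prob_def Let_def)
  qed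
  then show "i \<in> leaves A \<Longrightarrow> (\<Sum>j\<in>leaves B. \<pi> i j) = leaf_prob A i"
    and "j \<in> leaves B \<Longrightarrow> (\<Sum>i\<in>leaves A. \<pi> i j) = leaf_prob B j"
    by auto
qed

lemma regularized_feasible_imp_nested_feasible:
  "regularized_feasible A B T \<pi> \<Longrightarrow> nested_feasible A B T \<pi>"
  by (auto simp: regularized_feasible_def nested_feasible_def less_imp_le)

text \<open>Multiplied by the mass, the constraints are linear and homogeneous in the plan, hence
  stable under averaging.\<close>

lemma conditional_constraints_midpoint:
  assumes "conditional_constraints A B T \<pi>" and "conditional_constraints A B T \<rho>"
  shows "conditional_constraints A B T (\<lambda>i j. (\<pi> i j + \<rho> i j) / 2)"
proof -
  have "c * ((x + y) / 2) = (c * x + c * y) / 2" for c x y :: real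
    by (simp add: distrib_left)
  then show ?thesis
    using assms by (simp only: conditional_constraints_def Let_def sum_midpoint) simp
qed

lemma regularized_feasible_midpoint:
  assumes "nested_feasible A B T \<pi>" and "regularized_feasible A B T \<rho>"
  shows "regularized_feasible A B T (\<lambda>i j. (\<pi> i j + \<rho> i j) / 2)"
  using assms
  by (auto simp: nested_feasible_def regularized_feasible_def conditional_constraints_midpoint
      add_nonneg_pos sum_midpoint)

lemma transport_cost_midpoint:
  "transport_cost A B d r (\<lambda>i j. (\<pi> i j + \<rho> i j) / 2)
    = (transport_cost A B d r \<pi> + transport_cost A B d r \<rho>) / 2"
  by (simp add: transport_cost_def distrib_right sum_midpoint)

lemma entropy_midpoint_ge:
  assumes "nested_feasible A B T \<pi>" and "regularized_feasible A B T \<rho>"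
  shows "(entropy A B \<pi> + entropy A B \<rho>) / 2 \<le> entropy A B (\<lambda>i j. (\<pi> i j + \<rho> i j) / 2)"
proof -
  have "(\<Sum>i\<in>leaves A. \<Sum>j\<in>leaves B. (\<pi> i j + \<rho> i j) / 2 * ln ((\<pi> i j + \<rho> i j) / 2))
      \<le> (\<Sum>i\<in>leaves A. \<Sum>j\<in>leaves B. (\<pi> i j * ln (\<pi> i j) + \<rho> i j * ln (\<rho> i j)) / 2)"
    using assms
    by (intro sum_mono mult_ln_midpoint_le) (auto simp: nested_feasible_def regularized_feasible_def)
  then show ?thesis
    by (simp add: entropy_def sum_midpoint)
qed

lemma regularized_cost_midpoint_le:
  assumes "lam > 0" and "nested_feasible A B T \<pi>" and "regularized_feasible A B T \<rho>"
  shows "regularized_cost A B d r lam (\<lambda>i j. (\<pi> i j + \<rho> i j) / 2)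
    \<le> (regularized_cost A B d r lam \<pi> + regularized_cost A B d r lam \<rho>) / 2"
proof -
  have "1 / lam * ((entropy A B \<pi> + entropy A B \<rho>) / 2)
      \<le> 1 / lam * entropy A B (\<lambda>i j. (\<pi> i j + \<rho> i j) / 2)"
    using entropy_midpoint_ge[OF assms(2,3)] \<open>lam > 0\<close> by (intro mult_left_mono) simp_all
  then show ?thesis
    unfolding regularized_cost_def transport_cost_midpoint by argo
qed

lemma regularized_minimum_le_nested:
  assumes "lam > 0" and "nested_feasible A B T \<pi>"
    and min: "is_arg_min (regularized_cost A B d r lam) (regularized_feasible A B T) \<pi>S"
  shows "regularized_cost A B d r lam \<pi>S \<le> regularized_cost A B d r lam \<pi>"
proof -
  have S: "regularized_feasible A B T \<pi>S"
    using min by (simp add: is_arg_min_linorder)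
  have "regularized_cost A B d r lam \<pi>S
      \<le> regularized_cost A B d r lam (\<lambda>i j. (\<pi> i j + \<pi>S i j) / 2)"
    using min regularized_feasible_midpoint[OF assms(2) S] by (simp add: is_arg_min_linorder)
  with regularized_cost_midpoint_le[OF assms(1,2) S, of d r] show ?thesis
    by (simp add: field_simps)
qed

text \<open>Each entry lies between 0 and the total mass 1, so its logarithm is nonpositive unless
  the entry vanishes, and then the product is 0.\<close>

lemma entropy_nonneg:
  assumes "finite (leaves A)" and "finite (leaves B)" and \<pi>: "nested_feasible A B T \<pi>"
  shows "entropy A B \<pi> \<ge> 0"
proof -
  have nonneg: "\<pi> i j \<ge> 0" if "i \<in> leaves A" "j \<in> leaves B" for i j
    using \<pi> that by (simp add: nested_feasible_def)
  have "\<pi> i j * ln (\<pi> i j) \<le> 0" if ij: "i \<in> leaves A" "j \<in> leaves B" for i j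
  proof -
    have "\<pi> i j \<le> (\<Sum>j\<in>leaves B. \<pi> i j)"
      using assms(2) ij nonneg by (intro member_le_sum) auto
    also have "\<dots> \<le> (\<Sum>i\<in>leaves A. \<Sum>j\<in>leaves B. \<pi> i j)"
      using assms(1) ij nonneg
      by (intro member_le_sum[where f = "\<lambda>i. \<Sum>j\<in>leaves B. \<pi> i j"]) (auto intro: sum_nonneg)
    also have "\<dots> = 1"
      using \<pi> by (simp add: nested_feasible_def)
    finally show ?thesis
      using nonneg[OF ij] by (cases "\<pi> i j = 0") (auto intro: mult_nonneg_nonpos)
  qed
  then show ?thesis
    by (auto simp: entropy_def intro: sum_nonpos)
qed

text \<open>An additively separable integrand sees only the marginals of \<open>\<pi>\<close>;
  swapping the sums exposes the second one.\<close>

lemma sum_marginals: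
  fixes \<pi> :: "'a \<Rightarrow> 'b \<Rightarrow> real"
  assumes "\<And>i. i \<in> I \<Longrightarrow> (\<Sum>j\<in>J. \<pi> i j) = p i" and "\<And>j. j \<in> J \<Longrightarrow> (\<Sum>i\<in>I. \<pi> i j) = q j"
  shows "(\<Sum>i\<in>I. \<Sum>j\<in>J. \<pi> i j * (f i + g j)) = (\<Sum>i\<in>I. p i * f i) + (\<Sum>j\<in>J. q j * g j)"
proof -
  have "(\<Sum>i\<in>I. \<Sum>j\<in>J. \<pi> i j * g j) = (\<Sum>j\<in>J. \<Sum>i\<in>I. \<pi> i j * g j)"
    by (rule sum.swap)
  then show ?thesis
    using assms by (simp add: distrib_left sum.distrib flip: sum_distrib_right)
qed

text \<open>Gibbs' inequality bounds the entropy of \<open>\<pi>\<close> by its cross-entropy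
  relative to the product. The logarithm of the product is separable, so this cross-entropy depends
  only on the marginals, which \<open>\<pi>\<close> and the product share.\<close>

lemma entropy_le_entropy_product:
  assumes A: "is_scenario_tree A T" and B: "is_scenario_tree B T"
    and \<pi>: "nested_feasible A B T \<pi>"
  shows "entropy A B \<pi> \<le> entropy A B (\<lambda>i j. leaf_prob A i * leaf_prob B j)"
proof -
  note DA = is_scenario_treeD[OF A] and DB = is_scenario_treeD[OF B]
  let ?p = "leaf_prob A" and ?q = "leaf_prob B"
  have prod_total: "(\<Sum>i\<in>leaves A. \<Sum>j\<in>leaves B. ?p i * ?q j) = 1"
    using DA(5) DB(5) by (simp flip: sum_distrib_left)
  have ln_split: "(\<Sum>i\<in>leaves A. \<Sum>j\<in>leaves B. \<rho> i j * ln (?p i * ?q j))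
      = (\<Sum>i\<in>leaves A. \<Sum>j\<in>leaves B. \<rho> i j * (ln (?p i) + ln (?q j)))" for \<rho>
    using DA(4) DB(4) by (intro sum.cong refl) (simp add: ln_mult_pos)
  \<comment> \<open>The left-hand side is 0, as \<open>\<pi>\<close> and the product both have mass
    1.\<close>
  have "(\<Sum>i\<in>leaves A. \<Sum>j\<in>leaves B. \<pi> i j - ?p i * ?q j)
      \<le> (\<Sum>i\<in>leaves A. \<Sum>j\<in>leaves B. \<pi> i j * ln (\<pi> i j) - \<pi> i j * ln (?p i * ?q j))"
    using \<pi> DA(4) DB(4) by (intro sum_mono mult_ln_diff_ge) (auto simp: nested_feasible_def)
  then have "entropy A B \<pi> \<le> - (\<Sum>i\<in>leaves A. \<Sum>j\<in>leaves B. \<pi> i j * ln (?p i * ?q j))"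
    using \<pi> prod_total by (simp add: entropy_def nested_feasible_def sum_subtractf)
  also have "\<dots> = - ((\<Sum>i\<in>leaves A. ?p i * ln (?p i)) + (\<Sum>j\<in>leaves B. ?q j * ln (?q j)))"
    unfolding ln_split using nested_feasible_marginals[OF A B \<pi>] by (subst sum_marginals) auto
  also have "\<dots> = entropy A B (\<lambda>i j. ?p i * ?q j)"
    unfolding entropy_def ln_split using DA(5) DB(5)
    by (subst sum_marginals[where p = ?p and q = ?q])
      (simp_all flip: sum_distrib_left sum_distrib_right)
  finally show ?thesis .
qed

lemma nested_value_eq:
  assumes "is_arg_min (transport_cost A B d r) (nested_feasible A B T) \<pi>"
  shows "nested_value A B T d r = transport_cost A B d r \<pi>"
  unfolding nested_value_def using assms
  by (intro cInf_eq_minimum) (auto simp: is_arg_min_linorder)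

theorem corollary4p3:
  fixes A :: "'a scenario_tree" and B :: "'b scenario_tree" and T :: nat
    and d :: "'a \<Rightarrow> 'b \<Rightarrow> real" and r lam :: real
    and \<pi>W \<pi>S :: "'a \<Rightarrow> 'b \<Rightarrow> real" and dW dS deS :: real
  assumes "r \<ge> 1" and "lam > 0"
    and "is_scenario_tree A T" and "is_scenario_tree B T"
    and "\<And>i j. i \<in> leaves A \<Longrightarrow> j \<in> leaves B \<Longrightarrow> d i j \<ge> 0"
    and "is_arg_min (transport_cost A B d r) (nested_feasible A B T) \<pi>W"
    and "is_arg_min (regularized_cost A B d r lam) (regularized_feasible A B T) \<pi>S"
    and "dW = nested_value A B T d r"
    and "dS = transport_cost A B d r \<pi>S"
    and "deS = regularized_cost A B d r lam \<pi>S"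
  shows "(0 \<le> dS - dW \<and> dS - dW \<le> 1 / lam * (entropy A B \<pi>S - entropy A B \<pi>W)) \<and>
         (0 \<le> dW - deS \<and> dW - deS \<le> 1 / lam * entropy A B \<pi>S \<and>
          1 / lam * entropy A B \<pi>S
            \<le> 1 / lam * entropy A B (\<lambda>i j. leaf_prob A i * leaf_prob B j))"
proof -
  have W: "nested_feasible A B T \<pi>W" and S: "nested_feasible A B T \<pi>S"
    using assms(6,7) regularized_feasible_imp_nested_feasible by (auto simp: is_arg_min_linorder)
  have dW: "dW = transport_cost A B d r \<pi>W"
    using nested_value_eq[OF assms(6)] assms(8) by simp
  \<comment> \<open>\<open>\<pi>S\<close> competes in the nested problem.\<close>
  have "dW \<le> dS"
    using assms(6,9) S dW by (simp add: is_arg_min_linorder)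
  \<comment> \<open>With the formula for \<open>deS\<close> this is the upper bound on
    \<open>dS - dW\<close>; with nonnegative entropy of \<open>\<pi>W\<close> it gives
    \<open>deS \<le> dW\<close>.\<close>
  moreover have "deS \<le> dW - 1 / lam * entropy A B \<pi>W"
    using regularized_minimum_le_nested[OF assms(2) W assms(7)] assms(10) dW
    by (simp add: regularized_cost_def)
  moreover have "deS = dS - 1 / lam * entropy A B \<pi>S"
    using assms(9,10) by (simp add: regularized_cost_def)
  moreover have "0 \<le> 1 / lam * entropy A B \<pi>W"
    using entropy_nonneg[OF is_scenario_treeD(1)[OF assms(3)] is_scenario_treeD(1)[OF assms(4)] W]
      assms(2) by simp
  moreover have "1 / lam * entropy A B \<pi>S
      \<le> 1 / lam * entropy A B (\<lambda>i j. leaf_prob A i * leaf_prob B j)"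
    using entropy_le_entropy_product[OF assms(3,4) S] assms(2) by (intro mult_left_mono) simp_all
  ultimately show ?thesis
    unfolding right_diff_distrib by (intro conjI) linarith+
qed

end
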